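(* Let $\lambda$ be a nonzero real number. For every integer $n\ge 0$, $$\sum_{l=0}^{n}S_{2,\lambda}(n,l)d_{l,\lambda}(x)=\sum_{l=0}^{n}\sum_{m=0}^{l}\binom{n}{l}F_{n-l,\lambda}(1)(x-1)_{m,\lambda}S_{2,\lambda}(l,m).$$
   Context: For a nonzero real $\lambda$, the degenerate falling factorial is $(x)_{0,\lambda}=1$ and $(x)_{n,\lambda}=x(x-\lambda)\cdots(x-(n-1)\lambda)$ for $n\ge1$. The degenerate exponential function is $e_{\lambda}^{x}(t)=(1+\lambda t)^{x/\lambda}=\sum_{n\ge0}(x)_{n,\lambda}\frac{t^n}{n!}$, and $e_\lambda(t)=e_\lambda^1(t)$. The degenerate derangement polynomials $d_{n,\lambda}(x)$ are defined by $\frac{1}{1-t}e_{\lambda}^{x-1}(t)=\sum_{n\ge0}d_{n,\lambda}(x)\frac{t^n}{n!}$. The degenerate Stirling numbers of the second kind $S_{2,\lambda}(n,m)$ are defined by $\frac{1}{m!}(e_{\lambda}(t)-1)^m=\sum_{n\ge m}S_{2,\lambda}(n,m)\frac{t^n}{n!}$ for $m\ge0$. The degenerate Fubini polynomials $F_{n,\lambda}(y)$ are defined by $\frac{1}{1-y(e_{\lambda}(t)-1)}=\sum_{n\ge0}F_{n,\lambda}(y)\frac{t^n}{n!}$. *)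

theory Defs
  imports "HOL-Computational_Algebra.Formal_Power_Series"
begin

text \<open>
  Generating functions in \<open>t\<close> are formal power series over the reals, with \<open>t = fps_X\<close>.
  A sequence with exponential generating function \<open>G\<close> is read off as
  \<open>fact n * fps_nth G n\<close>.
\<close>

definition degen_ffact :: "real \<Rightarrow> real \<Rightarrow> nat \<Rightarrow> real" where
  "degen_ffact lam x n = (\<Prod>i<n. x - of_nat i * lam)"

definition degen_exp :: "real \<Rightarrow> real \<Rightarrow> real fps" where
  "degen_exp lam x = Abs_fps (\<lambda>n. degen_ffact lam x n / fact n)"

text \<open>The closed form \<open>(1 + lam * t) powr (x / lam)\<close>, read as a binomial series:\<close>

lemma degen_exp_eq_binomial:
  assumes "lam \<noteq> 0"
  shows "degen_exp lam x = fps_compose (fps_binomial (x / lam)) (fps_const lam * fps_X)"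
proof -
  have "lam ^ n * (\<Prod>i<n. x / lam - of_nat i) = degen_ffact lam x n" for n
    unfolding degen_ffact_def using assms
    by (induction n) (simp_all add: field_simps)
  then show ?thesis
    by (simp add: degen_exp_def fps_compose_linear gbinomial_prod_rev atLeast0LessThan fps_eq_iff)
qed

definition degen_derangement :: "real \<Rightarrow> nat \<Rightarrow> real \<Rightarrow> real" where
  "degen_derangement lam n x =
     fact n * fps_nth (1 / (1 - fps_X) * degen_exp lam (x - 1)) n"

definition degen_Stirling2 :: "real \<Rightarrow> nat \<Rightarrow> nat \<Rightarrow> real" where
  "degen_Stirling2 lam n m =
     fact n * fps_nth (fps_const (1 / fact m) * (degen_exp lam 1 - 1) ^ m) n"

text \<open>The series starts at \<open>n = m\<close>:\<close>

lemma degen_Stirling2_eq_0: "n < m \<Longrightarrow> degen_Stirling2 lam n m = 0"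
  by (simp add: degen_Stirling2_def degen_exp_def degen_ffact_def startsby_zero_power_prefix)

definition degen_Fubini :: "real \<Rightarrow> nat \<Rightarrow> real \<Rightarrow> real" where
  "degen_Fubini lam n y =
     fact n * fps_nth (1 / (1 - fps_const y * (degen_exp lam 1 - 1))) n"

end

theory Submission
  imports Defs
begin

text \<open>
  Summing a sequence against the degenerate Stirling numbers substitutes \<open>e\<^sub>\<lambda>(t) - 1\<close> for
  \<open>t\<close> in its exponential generating function. For the derangement polynomials the result is
  the product of the Fubini generating function \<open>1 / (1 - (e\<^sub>\<lambda>(t) - 1))\<close> and
  \<open>e\<^sub>\<lambda>\<^sup>x\<^sup>-\<^sup>1(e\<^sub>\<lambda>(t) - 1)\<close>; both sides of the identity are its coefficients.
\<close>

unbundle fps_syntax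

lemma degen_exp_minus_one_nth_0: "(degen_exp lam x - 1) $ 0 = 0"
  by (simp add: degen_exp_def degen_ffact_def)

text \<open>The factor \<open>fact l\<close> cancels the \<open>1 / fact l\<close> inside
  \<open>degen_Stirling2\<close>, which leaves the finite sum for a coefficient of a
  composition.\<close>

lemma sum_degen_Stirling2_eq_compose:
  "(\<Sum>l=0..n. degen_Stirling2 lam n l * (fact l * f $ l)) =
    fact n * (f oo (degen_exp lam 1 - 1)) $ n"
  by (simp add: degen_Stirling2_def fps_compose_nth sum_distrib_left mult_ac)

lemma fps_geometric_compose:
  fixes u :: "'a :: field fps"
  assumes "u $ 0 = 0"
  shows "(1 / (1 - fps_X)) oo u = 1 / (1 - u)"
  using assms
  by (simp add: fps_divide_compose fps_compose_sub_distrib)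

theorem theorem4:
  fixes lam x :: real and n :: nat
  assumes "lam \<noteq> 0"
  shows "(\<Sum>l=0..n. degen_Stirling2 lam n l * degen_derangement lam l x) =
    (\<Sum>l=0..n. \<Sum>m=0..l. of_nat (n choose l) * degen_Fubini lam (n - l) 1 *
       degen_ffact lam (x - 1) m * degen_Stirling2 lam l m)"
proof -
  define u where "u = degen_exp lam 1 - 1"
  define g where "g = degen_exp lam (x - 1)"
  have u0: "u $ 0 = 0"
    unfolding u_def by (rule degen_exp_minus_one_nth_0)
  \<comment> \<open>\<open>g\<close> has exponential coefficients
    \<open>degen_ffact lam (x - 1) m\<close>, so the same substitution applies.\<close>
  have inner: "(\<Sum>m=0..l. degen_ffact lam (x - 1) m * degen_Stirling2 lam l m) =
      fact l * (g oo u) $ l" for l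
    using sum_degen_Stirling2_eq_compose[of lam l g]
    by (simp add: u_def g_def degen_exp_def mult.commute)
  have "(\<Sum>l=0..n. degen_Stirling2 lam n l * degen_derangement lam l x) =
      fact n * ((1 / (1 - fps_X) * g) oo u) $ n"
    unfolding degen_derangement_def u_def g_def by (rule sum_degen_Stirling2_eq_compose)
  \<comment> \<open>With \<open>g oo u\<close> on the left, the Cauchy product gives it index
    \<open>l\<close> and the Fubini factor \<open>n - l\<close>.\<close>
  also have "\<dots> = fact n * ((g oo u) * (1 / (1 - u))) $ n"
    by (simp only: fps_compose_mult_distrib[OF u0] fps_geometric_compose[OF u0] mult.commute)
  also have "\<dots> = (\<Sum>l=0..n. of_nat (n choose l) * degen_Fubini lam (n - l) 1 *
      (fact l * (g oo u) $ l))"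
    unfolding fps_mult_nth sum_distrib_left
    by (rule sum.cong) (simp_all add: degen_Fubini_def binomial_fact flip: u_def)
  also have "\<dots> = (\<Sum>l=0..n. \<Sum>m=0..l. of_nat (n choose l) * degen_Fubini lam (n - l) 1 *
       degen_ffact lam (x - 1) m * degen_Stirling2 lam l m)"
    unfolding inner[symmetric] by (simp add: sum_distrib_left mult.assoc)
  finally show ?thesis .
qed

end
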